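(* Let $X$ be a finite metric space, $a_0\in X$, $P\subseteq\mathcal{P}_X$ with $P=P^{-1}$ and $X\setminus\{a_0\}\subseteq P(a_0)$. Let $N\trianglelefteq\mathbb{F}(P)$ be of finite index and satisfy (C1), (C2) and (C3). Let $G=\Phi_N(\mathbb{F}(P))$ and let $\rho$ be a $G$-invariant pseudometric on $\Gamma_N$ consistent with $w_N$. Then the map $\overline{e_N}:X\to\overline{\Gamma_N}$ is an isometric embedding, and, identifying $X$ with its image, $(\overline{\Gamma_N},\overline{\Phi_N})$ is a finite minimal $P$-type S-extension of $X$.
   Context: A partial isometry of $X$ is an isometry between finite subsets of $X$; $\mathcal{P}_X$ is the set of those not contained in the identity; $P(a_0)=\{p(a_0):p\in P,\ a_0\in\mathrm{dom}(p)\}$. A $P$-type S-extension of $X$ is $(Y,\phi)$ with $Y$ a metric space extending $X$ and $\phi:P\to\mathrm{Iso}(Y)$, $\phi(p)\restriction\mathrm{dom}(p)=p$; $\phi$ is extended to a homomorphism $\mathbb{F}(P)\to\mathrm{Iso}(Y)$, $\mathbb{F}(P)$ the free group on $P$ with $p^{-1}\in P$ identified with the formal inverse of $p$. Minimal: every $y\in Y$ is $\phi(g)(a_0)$ for some $g\in\mathbb{F}(P)$. Let $H\le\mathbb{F}(P)$ be the subgroup of elements represented by words $p_1\cdots p_n$ ($p_i\in P$) with $p_1(p_2(\cdots p_n(a_0)\cdots))$ defined and equal to $a_0$. Conditions on $N\trianglelefteq\mathbb{F}(P)$ (all $p,q,r,s,r_i,s_i\in P\cup\{1\}$ defined at $a_0$):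 (C1) if $d_X(p(a_0),q(a_0))\ne d_X(r(a_0),s(a_0))$ then $N\cap pHr^{-1}sHq^{-1}=\emptyset$; (C2) if $p(a_0)\ne q(a_0)$ then $N\cap pHq^{-1}=\emptyset$; (C3) if $d_X(p(a_0),q(a_0))>\sum_{i=1}^n d_X(r_i(a_0),s_i(a_0))$ then $N\cap pHr_1^{-1}s_1H\cdots Hr_n^{-1}s_nHq^{-1}=\emptyset$. $\Gamma_N=\{gNH:g\in\mathbb{F}(P)\}$; the weighted graph $(\Gamma_N,w_N)$ has an edge between $gpNH\neq gqNH$ whenever $g\in\mathbb{F}(P)$, $p,q\in P\cup\{1\}$ defined at $a_0$, with weight $d_X(p(a_0),q(a_0))$. $\Phi_N(g)(hNH)=ghNH$ defines a homomorphism $\mathbb{F}(P)\to\mathrm{Sym}(\Gamma_N)$. A pseudometric $\rho$ is consistent with $w_N$ if $\rho=w_N$ on edges; $G$-invariant if preserved by all elements of $G$. $(\overline{\Gamma_N},\overline\rho)$ is the metric identification ($x\sim y$ iff $\rho(x,y)=0$), $\overline{\Phi_N}(p)([x])=[\Phi_N(p)(x)]$, and $\overline{e_N}(a_0)=[NH]$, $\overline{e_N}(a)=[pNH]$ for $a\neq a_0$ and any $p\in P$ with $p(a_0)=a$; partial isometries $p\in P$ act on $\overline{e_N}(X)$ via $\overline{e_N}(a)\mapsto\overline{e_N}(p(a))$. *)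

theory Defs
  imports
    "HOL-Analysis.Abstract_Metric_Spaces"
    "HOL-Algebra.Left_Coset"
    "HOL-Algebra.Bij"
begin

section \<open>Partial isometries\<close>

text \<open>Partial maps are represented by their graphs, so that the inverse of a partial isometry is its
  \<^const>\<open>converse\<close>, being contained in the identity is \<open>p \<subseteq> Id\<close>, and ``\<open>p\<close> is defined at \<open>a\<close> with
  value \<open>b\<close>'' is \<open>(a, b) \<in> p\<close>.\<close>

definition partial_isometry :: "'a set \<Rightarrow> ('a \<Rightarrow> 'a \<Rightarrow> real) \<Rightarrow> 'a rel \<Rightarrow> bool" where
  "partial_isometry X d p \<longleftrightarrow>
     (\<exists>A B f. finite A \<and> A \<subseteq> X \<and> finite B \<and> B \<subseteq> X \<and> bij_betw f A B \<and>
        (\<forall>x\<in>A. \<forall>y\<in>A. d (f x) (f y) = d x y) \<and> p = {(x, f x) | x. x \<in> A})"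

definition nontrivial_partial_isometries :: "'a set \<Rightarrow> ('a \<Rightarrow> 'a \<Rightarrow> real) \<Rightarrow> 'a rel set" where
  "nontrivial_partial_isometries X d = {p. partial_isometry X d p \<and> \<not> p \<subseteq> Id}"

text \<open>The set \<open>P(a\<^sub>0)\<close>.\<close>

definition values_at :: "'a rel set \<Rightarrow> 'a \<Rightarrow> 'a set" where
  "values_at P a\<^sub>0 = {b. \<exists>p\<in>P. (a\<^sub>0, b) \<in> p}"


section \<open>The group of words in partial isometries\<close>

text \<open>For \<open>P = P\<^sup>-\<^sup>1\<close>, the free group on \<open>P\<close> in which \<open>p\<^sup>-\<^sup>1 \<in> P\<close> is identified with the formal inverse
  of \<open>p\<close>: words over \<open>P\<close> modulo insertion and deletion of \<open>p p\<^sup>-\<^sup>1\<close>. If \<open>p\<close> equals its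
  own inverse, the identification makes \<open>p\<close> an element of order two.\<close>

definition cancel :: "'a rel set \<Rightarrow> 'a rel list rel" where
  "cancel P = {(u @ [p, converse p] @ v, u @ v) | u v p. u \<in> lists P \<and> v \<in> lists P \<and> p \<in> P}"

definition word_equiv :: "'a rel set \<Rightarrow> 'a rel list rel" where
  "word_equiv P = (cancel P \<union> converse (cancel P))\<^sup>* \<inter> (lists P \<times> lists P)"

definition word_class :: "'a rel set \<Rightarrow> 'a rel list \<Rightarrow> 'a rel list set" where
  "word_class P w = word_equiv P `` {w}"

definition free_grp :: "'a rel set \<Rightarrow> 'a rel list set monoid" where
  "free_grp P =
     \<lparr>carrier = lists P // word_equiv P,
      mult = (\<lambda>g h. \<Union>u\<in>g. \<Union>v\<in>h. word_class P (u @ v)),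
      one = word_class P []\<rparr>"

abbreviation gen :: "'a rel set \<Rightarrow> 'a rel \<Rightarrow> 'a rel list set" where
  "gen P p \<equiv> word_class P [p]"


section \<open>Extensions on which the partial isometries become total\<close>

definition IsoGroup :: "'b set \<Rightarrow> ('b \<Rightarrow> 'b \<Rightarrow> real) \<Rightarrow> ('b \<Rightarrow> 'b) monoid" where
  "IsoGroup Y dY =
     BijGroup Y \<lparr>carrier := {f \<in> Bij Y. \<forall>x\<in>Y. \<forall>y\<in>Y. dY (f x) (f y) = dY x y}\<rparr>"

definition isometric_embedding ::
  "'a set \<Rightarrow> ('a \<Rightarrow> 'a \<Rightarrow> real) \<Rightarrow> 'b set \<Rightarrow> ('b \<Rightarrow> 'b \<Rightarrow> real) \<Rightarrow> ('a \<Rightarrow> 'b) \<Rightarrow> bool" where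
  "isometric_embedding X d Y dY e \<longleftrightarrow>
     e \<in> X \<rightarrow> Y \<and> (\<forall>x\<in>X. \<forall>y\<in>X. dY (e x) (e y) = d x y)"

text \<open>\<open>\<Phi>\<close> is the extension of \<open>\<phi> : P \<rightarrow> Iso(Y)\<close> to a homomorphism; since \<open>P\<close> generates the group, it is
  unique on the carrier. Its existence says that \<open>\<phi>(p\<^sup>-\<^sup>1) = \<phi>(p)\<^sup>-\<^sup>1\<close> for \<open>p \<in> P\<close>.\<close>

definition hom_extension ::
  "'a rel set \<Rightarrow> 'b set \<Rightarrow> ('b \<Rightarrow> 'b \<Rightarrow> real) \<Rightarrow> ('a rel \<Rightarrow> 'b \<Rightarrow> 'b)
    \<Rightarrow> ('a rel list set \<Rightarrow> 'b \<Rightarrow> 'b) \<Rightarrow> bool" where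
  "hom_extension P Y dY \<phi> \<Phi> \<longleftrightarrow>
     \<Phi> \<in> hom (free_grp P) (IsoGroup Y dY) \<and> (\<forall>p\<in>P. \<Phi> (gen P p) = \<phi> p)"

text \<open>The space \<open>X\<close> is identified with its image under the isometric embedding \<open>e : X \<rightarrow> Y\<close>, so that
  \<open>p\<close> acts on \<open>e(X)\<close> by \<open>e(a) \<mapsto> e(p(a))\<close>; the case \<open>X \<subseteq> Y\<close> is \<open>e = id\<close>.\<close>

definition S_extension ::
  "'a set \<Rightarrow> ('a \<Rightarrow> 'a \<Rightarrow> real) \<Rightarrow> 'a rel set \<Rightarrow> 'b set \<Rightarrow> ('b \<Rightarrow> 'b \<Rightarrow> real) \<Rightarrow> ('a \<Rightarrow> 'b)
    \<Rightarrow> ('a rel \<Rightarrow> 'b \<Rightarrow> 'b) \<Rightarrow> bool" where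
  "S_extension X d P Y dY e \<phi> \<longleftrightarrow>
     Metric_space Y dY \<and> isometric_embedding X d Y dY e \<and>
     \<phi> \<in> P \<rightarrow> carrier (IsoGroup Y dY) \<and>
     (\<forall>p\<in>P. \<forall>(a, b)\<in>p. \<phi> p (e a) = e b) \<and>
     (\<exists>\<Phi>. hom_extension P Y dY \<phi> \<Phi>)"

definition minimal_S_extension ::
  "'a set \<Rightarrow> ('a \<Rightarrow> 'a \<Rightarrow> real) \<Rightarrow> 'a \<Rightarrow> 'a rel set \<Rightarrow> 'b set \<Rightarrow> ('b \<Rightarrow> 'b \<Rightarrow> real) \<Rightarrow> ('a \<Rightarrow> 'b)
    \<Rightarrow> ('a rel \<Rightarrow> 'b \<Rightarrow> 'b) \<Rightarrow> bool" where
  "minimal_S_extension X d a\<^sub>0 P Y dY e \<phi> \<longleftrightarrow>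
     S_extension X d P Y dY e \<phi> \<and>
     (\<exists>\<Phi>. hom_extension P Y dY \<phi> \<Phi> \<and> (\<forall>y\<in>Y. \<exists>g\<in>carrier (free_grp P). y = \<Phi> g (e a\<^sub>0)))"


section \<open>The subgroup H and the conditions on N\<close>

fun word_rel :: "'a rel list \<Rightarrow> 'a rel" where
  "word_rel [] = Id"
| "word_rel (p # w) = word_rel w O p"

definition stab :: "'a rel set \<Rightarrow> 'a \<Rightarrow> 'a rel list set set" where
  "stab P a\<^sub>0 = {word_class P w | w. w \<in> lists P \<and> (a\<^sub>0, a\<^sub>0) \<in> word_rel w}"

text \<open>The elements \<open>p \<in> P \<union> {1}\<close> defined at \<open>a\<^sub>0\<close>, each paired with its value \<open>p(a\<^sub>0)\<close>.\<close>

definition gens_at :: "'a rel set \<Rightarrow> 'a \<Rightarrow> ('a rel list set \<times> 'a) set" where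
  "gens_at P a\<^sub>0 =
     insert (\<one>\<^bsub>free_grp P\<^esub>, a\<^sub>0) {(gen P p, b) | p b. p \<in> P \<and> (a\<^sub>0, b) \<in> p}"

text \<open>\<open>p H r\<^sub>1\<^sup>-\<^sup>1 s\<^sub>1 H \<dots> H r\<^sub>n\<^sup>-\<^sup>1 s\<^sub>n H q\<^sup>-\<^sup>1\<close>, which is \<open>p H q\<^sup>-\<^sup>1\<close> for \<open>n = 0\<close>.\<close>

definition H_product ::
  "('g, 'm) monoid_scheme \<Rightarrow> 'g set \<Rightarrow> 'g \<Rightarrow> ('g \<times> 'g) list \<Rightarrow> 'g \<Rightarrow> 'g set" where
  "H_product F H p rs q =
     p <#\<^bsub>F\<^esub> (foldr (\<lambda>(r, s) K. H <#>\<^bsub>F\<^esub> ((inv\<^bsub>F\<^esub> r \<otimes>\<^bsub>F\<^esub> s) <#\<^bsub>F\<^esub> K)) rs H) #>\<^bsub>F\<^esub> (inv\<^bsub>F\<^esub> q)"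

definition cond_C1 ::
  "('a \<Rightarrow> 'a \<Rightarrow> real) \<Rightarrow> 'a \<Rightarrow> 'a rel set \<Rightarrow> 'a rel list set set \<Rightarrow> bool" where
  "cond_C1 d a\<^sub>0 P N \<longleftrightarrow>
     (\<forall>(p, a)\<in>gens_at P a\<^sub>0. \<forall>(q, b)\<in>gens_at P a\<^sub>0. \<forall>(r, a')\<in>gens_at P a\<^sub>0. \<forall>(s, b')\<in>gens_at P a\<^sub>0.
        d a b \<noteq> d a' b' \<longrightarrow> N \<inter> H_product (free_grp P) (stab P a\<^sub>0) p [(r, s)] q = {})"

definition cond_C2 :: "'a \<Rightarrow> 'a rel set \<Rightarrow> 'a rel list set set \<Rightarrow> bool" where
  "cond_C2 a\<^sub>0 P N \<longleftrightarrow>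
     (\<forall>(p, a)\<in>gens_at P a\<^sub>0. \<forall>(q, b)\<in>gens_at P a\<^sub>0.
        a \<noteq> b \<longrightarrow> N \<inter> H_product (free_grp P) (stab P a\<^sub>0) p [] q = {})"

definition cond_C3 ::
  "('a \<Rightarrow> 'a \<Rightarrow> real) \<Rightarrow> 'a \<Rightarrow> 'a rel set \<Rightarrow> 'a rel list set set \<Rightarrow> bool" where
  "cond_C3 d a\<^sub>0 P N \<longleftrightarrow>
     (\<forall>(p, a)\<in>gens_at P a\<^sub>0. \<forall>(q, b)\<in>gens_at P a\<^sub>0.
        \<forall>rs\<in>lists (gens_at P a\<^sub>0 \<times> gens_at P a\<^sub>0).
          rs \<noteq> [] \<and> d a b > (\<Sum>((r, a'), (s, b'))\<leftarrow>rs. d a' b') \<longrightarrow>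
          N \<inter> H_product (free_grp P) (stab P a\<^sub>0) p (map (map_prod fst fst) rs) q = {})"


section \<open>The weighted graph and its pseudometrics\<close>

definition Gamma :: "'a \<Rightarrow> 'a rel set \<Rightarrow> 'a rel list set set \<Rightarrow> 'a rel list set set set" where
  "Gamma a\<^sub>0 P N =
     lcosets\<^bsub>free_grp P\<^esub> (N <#>\<^bsub>free_grp P\<^esub> stab P a\<^sub>0)"

text \<open>Triples \<open>(x, y, w)\<close> where \<open>x\<close> and \<open>y\<close> are joined by an edge of weight \<open>w\<close>. Condition
  \<^const>\<open>cond_C1\<close> makes \<open>w\<close> a function of \<open>x\<close> and \<open>y\<close>.\<close>

definition weighted_edges ::
  "('a \<Rightarrow> 'a \<Rightarrow> real) \<Rightarrow> 'a \<Rightarrow> 'a rel set \<Rightarrow> 'a rel list set set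
    \<Rightarrow> ('a rel list set set \<times> 'a rel list set set \<times> real) set" where
  "weighted_edges d a\<^sub>0 P N =
     {(x, y, w). x \<noteq> y \<and>
        (\<exists>g\<in>carrier (free_grp P). \<exists>(p, a)\<in>gens_at P a\<^sub>0. \<exists>(q, b)\<in>gens_at P a\<^sub>0.
           x = (g \<otimes>\<^bsub>free_grp P\<^esub> p) <#\<^bsub>free_grp P\<^esub> (N <#>\<^bsub>free_grp P\<^esub> stab P a\<^sub>0) \<and>
           y = (g \<otimes>\<^bsub>free_grp P\<^esub> q) <#\<^bsub>free_grp P\<^esub> (N <#>\<^bsub>free_grp P\<^esub> stab P a\<^sub>0) \<and>
           w = d a b)}"

definition Phi ::
  "'a \<Rightarrow> 'a rel set \<Rightarrow> 'a rel list set set \<Rightarrow> 'a rel list set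
    \<Rightarrow> 'a rel list set set \<Rightarrow> 'a rel list set set" where
  "Phi a\<^sub>0 P N g = (\<lambda>x\<in>Gamma a\<^sub>0 P N. g <#\<^bsub>free_grp P\<^esub> x)"

definition pseudometric_on :: "'b set \<Rightarrow> ('b \<Rightarrow> 'b \<Rightarrow> real) \<Rightarrow> bool" where
  "pseudometric_on M \<rho> \<longleftrightarrow>
     (\<forall>x\<in>M. \<rho> x x = 0) \<and> (\<forall>x\<in>M. \<forall>y\<in>M. 0 \<le> \<rho> x y \<and> \<rho> x y = \<rho> y x) \<and>
     (\<forall>x\<in>M. \<forall>y\<in>M. \<forall>z\<in>M. \<rho> x z \<le> \<rho> x y + \<rho> y z)"

definition invariant_under :: "('b \<Rightarrow> 'b) set \<Rightarrow> 'b set \<Rightarrow> ('b \<Rightarrow> 'b \<Rightarrow> real) \<Rightarrow> bool" where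
  "invariant_under G M \<rho> \<longleftrightarrow> (\<forall>f\<in>G. \<forall>x\<in>M. \<forall>y\<in>M. \<rho> (f x) (f y) = \<rho> x y)"

definition consistent_with :: "('b \<times> 'b \<times> real) set \<Rightarrow> ('b \<Rightarrow> 'b \<Rightarrow> real) \<Rightarrow> bool" where
  "consistent_with E \<rho> \<longleftrightarrow> (\<forall>(x, y, w)\<in>E. \<rho> x y = w)"


section \<open>Metric identification\<close>

definition zero_rel :: "'b set \<Rightarrow> ('b \<Rightarrow> 'b \<Rightarrow> real) \<Rightarrow> 'b rel" where
  "zero_rel M \<rho> = {(x, y). x \<in> M \<and> y \<in> M \<and> \<rho> x y = 0}"

definition metric_ident :: "'b set \<Rightarrow> ('b \<Rightarrow> 'b \<Rightarrow> real) \<Rightarrow> 'b set set" where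
  "metric_ident M \<rho> = M // zero_rel M \<rho>"

text \<open>The value \<open>0\<close> off the carrier is needed because \<^locale>\<open>Metric_space\<close> asks for nonnegativity and
  symmetry on the whole type.\<close>

definition ident_dist :: "'b set \<Rightarrow> ('b \<Rightarrow> 'b \<Rightarrow> real) \<Rightarrow> 'b set \<Rightarrow> 'b set \<Rightarrow> real" where
  "ident_dist M \<rho> A B =
     (if A \<in> metric_ident M \<rho> \<and> B \<in> metric_ident M \<rho>
      then the_elem {\<rho> x y | x y. x \<in> A \<and> y \<in> B} else 0)"

text \<open>The map \<open>[x] \<mapsto> [f x]\<close>; the union is over equal classes when \<open>f\<close> preserves \<open>\<rho>\<close>.\<close>

definition ident_map :: "'b set \<Rightarrow> ('b \<Rightarrow> 'b \<Rightarrow> real) \<Rightarrow> ('b \<Rightarrow> 'b) \<Rightarrow> 'b set \<Rightarrow> 'b set" where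
  "ident_map M \<rho> f = (\<lambda>A\<in>metric_ident M \<rho>. \<Union>x\<in>A. zero_rel M \<rho> `` {f x})"

definition Phi_bar ::
  "'a \<Rightarrow> 'a rel set \<Rightarrow> 'a rel list set set
    \<Rightarrow> ('a rel list set set \<Rightarrow> 'a rel list set set \<Rightarrow> real)
    \<Rightarrow> 'a rel \<Rightarrow> 'a rel list set set set \<Rightarrow> 'a rel list set set set" where
  "Phi_bar a\<^sub>0 P N \<rho> p = ident_map (Gamma a\<^sub>0 P N) \<rho> (Phi a\<^sub>0 P N (gen P p))"

text \<open>The coset \<open>pNH\<close> does not depend on the \<open>p \<in> P\<close> chosen with \<open>p(a\<^sub>0) = a\<close>, since \<open>p(a\<^sub>0) = q(a\<^sub>0)\<close>
  gives \<open>q\<^sup>-\<^sup>1p \<in> H\<close>.\<close>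

definition e_bar ::
  "'a \<Rightarrow> 'a rel set \<Rightarrow> 'a rel list set set
    \<Rightarrow> ('a rel list set set \<Rightarrow> 'a rel list set set \<Rightarrow> real)
    \<Rightarrow> 'a \<Rightarrow> 'a rel list set set set" where
  "e_bar a\<^sub>0 P N \<rho> a =
     zero_rel (Gamma a\<^sub>0 P N) \<rho> ``
       {if a = a\<^sub>0 then N <#>\<^bsub>free_grp P\<^esub> stab P a\<^sub>0
        else gen P (SOME p. p \<in> P \<and> (a\<^sub>0, a) \<in> p)
               <#\<^bsub>free_grp P\<^esub> (N <#>\<^bsub>free_grp P\<^esub> stab P a\<^sub>0)}"

end

theory Submission
  imports Defs "HOL-Algebra.SndIsomorphismGrp"
begin

text \<open>A word carrying \<open>a\<^sub>0\<close> to \<open>a\<close> determines its coset of \<open>K = NH\<close>, since two such words differ by an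
  element of \<open>H\<close>; this embeds \<open>X\<close> into \<open>\<Gamma>\<^sub>N\<close> equivariantly, and by (C2) distinct points go to distinct
  cosets. Those cosets are joined by an edge of weight \<open>d a b\<close> (take \<open>g = 1\<close>), so consistency of \<open>\<rho>\<close>
  makes the embedding isometric. Left translation acts transitively on the finitely many cosets
  and, \<open>\<rho>\<close> being invariant, descends to isometries of the metric identification.\<close>

section \<open>The group of words\<close>

lemma equiv_word_equiv: "equiv (lists P) (word_equiv P)"
proof (rule equivI)
  show "word_equiv P \<subseteq> lists P \<times> lists P"
    by (auto simp: word_equiv_def)
  show "refl_on (lists P) (word_equiv P)"
    by (auto simp: refl_on_def word_equiv_def)
  have "sym ((cancel P \<union> converse (cancel P))\<^sup>*)"
    by (intro sym_rtrancl sym_Un_converse)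
  then show "sym (word_equiv P)"
    by (auto simp: word_equiv_def sym_def)
  show "trans (word_equiv P)"
    by (auto simp: word_equiv_def trans_def)
qed

lemma cancel_context:
  assumes "(u, v) \<in> cancel P" "a \<in> lists P" "b \<in> lists P"
  shows "(a @ u @ b, a @ v @ b) \<in> cancel P"
proof -
  obtain x y p where xy: "x \<in> lists P" "y \<in> lists P" "p \<in> P"
    and uv: "u = x @ [p, converse p] @ y" "v = x @ y"
    using assms(1) by (auto simp: cancel_def)
  have "a @ u @ b = (a @ x) @ [p, converse p] @ (y @ b)" "a @ v @ b = (a @ x) @ (y @ b)"
    using uv by auto
  moreover have "a @ x \<in> lists P" "y @ b \<in> lists P"
    using xy assms(2,3) by auto
  ultimately show ?thesis
    unfolding cancel_def using xy(3) by blast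
qed

text \<open>A single insertion or cancellation remains one inside a longer word, so a chain of them
  can be carried out in any context, one step at a time. This is what makes concatenation well
  defined on classes.\<close>

lemma word_equiv_context:
  assumes "(u, v) \<in> word_equiv P" "a \<in> lists P" "b \<in> lists P"
  shows "(a @ u @ b, a @ v @ b) \<in> word_equiv P"
proof -
  have "(u, v) \<in> (cancel P \<union> converse (cancel P))\<^sup>*"
    using assms(1) by (simp add: word_equiv_def)
  then have "(a @ u @ b, a @ v @ b) \<in> (cancel P \<union> converse (cancel P))\<^sup>*"
  proof induction
    case (step y z)
    then have "(a @ y @ b, a @ z @ b) \<in> cancel P \<union> converse (cancel P)"
      using cancel_context[OF _ assms(2,3)] by blast
    with step.IH show ?case
      by (rule rtrancl_into_rtrancl)
  qed simp
  then show ?thesis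
    using assms by (auto simp: word_equiv_def)
qed

lemma word_equiv_append:
  assumes "(u, u') \<in> word_equiv P" "(v, v') \<in> word_equiv P"
  shows "(u @ v, u' @ v') \<in> word_equiv P"
proof -
  have "u' \<in> lists P" "v \<in> lists P"
    using assms by (auto simp: word_equiv_def)
  then have "(u @ v, u' @ v) \<in> word_equiv P" "(u' @ v, u' @ v') \<in> word_equiv P"
    using word_equiv_context[OF assms(1), of "[]" v] word_equiv_context[OF assms(2), of u' "[]"]
    by auto
  then show ?thesis
    using equiv_word_equiv[of P] by (meson equivE transD)
qed

lemma word_class_eq:
  "(u, v) \<in> word_equiv P \<Longrightarrow> word_class P u = word_class P v"
  unfolding word_class_def by (rule equiv_class_eq[OF equiv_word_equiv])

lemma word_class_carrier [intro]: "w \<in> lists P \<Longrightarrow> word_class P w \<in> carrier (free_grp P)"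
  by (simp add: free_grp_def word_class_def quotientI)

lemma carrier_free_grpE:
  assumes "g \<in> carrier (free_grp P)"
  obtains w where "w \<in> lists P" "g = word_class P w"
  using assms by (auto simp: free_grp_def word_class_def elim!: quotientE)

lemma one_free_grp: "\<one>\<^bsub>free_grp P\<^esub> = word_class P []"
  by (simp add: free_grp_def)

text \<open>The product in \<open>free_grp\<close> is a union over all pairs of representatives. All
  these concatenations have the same class, so the union collapses and computations may use one
  representative each.\<close>

lemma mult_word_class:
  assumes "u \<in> lists P" "v \<in> lists P"
  shows "word_class P u \<otimes>\<^bsub>free_grp P\<^esub> word_class P v = word_class P (u @ v)"
proof -
  have "word_class P (u' @ v') = word_class P (u @ v)"
    if "u' \<in> word_class P u" "v' \<in> word_class P v" for u' v'
    using that word_class_eq[OF word_equiv_append] by (fastforce simp: word_class_def)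
  moreover have "u \<in> word_class P u" "v \<in> word_class P v"
    using assms equiv_class_self[OF equiv_word_equiv] by (auto simp: word_class_def)
  ultimately have "(\<Union>u'\<in>word_class P u. \<Union>v'\<in>word_class P v. word_class P (u' @ v')) =
      word_class P (u @ v)"
    by (intro UN_constant_eq[of u] UN_constant_eq[of v] ballI)
  then show ?thesis
    by (simp add: free_grp_def)
qed

section \<open>Formal inverses of words and the group axioms\<close>

definition inv_word :: "'a rel list \<Rightarrow> 'a rel list" where
  "inv_word w = rev (map converse w)"

lemma inv_word_lists:
  assumes "converse ` P = P" "w \<in> lists P"
  shows "inv_word w \<in> lists P"
proof -
  have "converse p \<in> P" if "p \<in> P" for p
    using assms(1) that by blast
  then show ?thesis
    using assms(2) by (simp add: inv_word_def in_lists_conv_set)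
qed

text \<open>The product cancels from the middle outwards: the first letter of the right-hand word
  meets its converse, and what remains is the same product for the tail.\<close>

lemma word_class_inv_word_mult:
  assumes P: "converse ` P = P" and w: "w \<in> lists P"
  shows "word_class P (inv_word w @ w) = word_class P []"
  using w
proof (induction w)
  case (Cons p w)
  \<comment> \<open>\<open>cancel\<close> only deletes a letter followed by its converse, so the
    pair in the middle is read with \<open>converse p\<close> as the letter and \<open>p\<close> as
    \<open>converse (converse p)\<close>.\<close>
  have "(inv_word w @ [converse p, converse (converse p)] @ w, inv_word w @ w) \<in> cancel P"
    using inv_word_lists[OF P Cons.hyps(2)] Cons.hyps P unfolding cancel_def by blast
  moreover have "inv_word (p # w) @ p # w \<in> lists P" "inv_word w @ w \<in> lists P"
    using inv_word_lists[OF P] Cons.hyps by (simp_all add: P)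
  ultimately have "(inv_word (p # w) @ p # w, inv_word w @ w) \<in> word_equiv P"
    by (auto simp: word_equiv_def inv_word_def)
  then show ?case
    using Cons.IH word_class_eq by blast
qed (simp add: inv_word_def)

lemma group_free_grp:
  assumes P: "converse ` P = P"
  shows "group (free_grp P)"
proof (rule groupI)
  show "\<one>\<^bsub>free_grp P\<^esub> \<in> carrier (free_grp P)"
    by (auto simp: one_free_grp)
next
  fix g h assume "g \<in> carrier (free_grp P)" "h \<in> carrier (free_grp P)"
  then show "g \<otimes>\<^bsub>free_grp P\<^esub> h \<in> carrier (free_grp P)"
    by (elim carrier_free_grpE) (simp add: mult_word_class word_class_carrier)
next
  fix g h k
  assume "g \<in> carrier (free_grp P)" "h \<in> carrier (free_grp P)" "k \<in> carrier (free_grp P)"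
  then show "g \<otimes>\<^bsub>free_grp P\<^esub> h \<otimes>\<^bsub>free_grp P\<^esub> k = g \<otimes>\<^bsub>free_grp P\<^esub> (h \<otimes>\<^bsub>free_grp P\<^esub> k)"
    by (elim carrier_free_grpE) (simp add: mult_word_class)
next
  fix g assume "g \<in> carrier (free_grp P)"
  then show "\<one>\<^bsub>free_grp P\<^esub> \<otimes>\<^bsub>free_grp P\<^esub> g = g"
    by (elim carrier_free_grpE) (simp add: mult_word_class one_free_grp)
next
  fix g assume "g \<in> carrier (free_grp P)"
  then obtain w where w: "w \<in> lists P" "g = word_class P w"
    by (rule carrier_free_grpE)
  then have "word_class P (inv_word w) \<otimes>\<^bsub>free_grp P\<^esub> g = \<one>\<^bsub>free_grp P\<^esub>"
    using inv_word_lists[OF P w(1)]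
    by (simp add: mult_word_class word_class_inv_word_mult[OF P] one_free_grp)
  then show "\<exists>h\<in>carrier (free_grp P). h \<otimes>\<^bsub>free_grp P\<^esub> g = \<one>\<^bsub>free_grp P\<^esub>"
    using inv_word_lists[OF P w(1)] by blast
qed

lemma inv_word_class:
  assumes P: "converse ` P = P" and w: "w \<in> lists P"
  shows "inv\<^bsub>free_grp P\<^esub> (word_class P w) = word_class P (inv_word w)"
  using assms inv_word_lists[OF assms]
  by (intro group.inv_equality[OF group_free_grp[OF P]])
    (simp_all add: mult_word_class one_free_grp word_class_inv_word_mult word_class_carrier)

section \<open>Words as partial maps, and the subgroup H\<close>

lemma word_rel_append: "word_rel (u @ v) = word_rel v O word_rel u"
  by (induction u) auto

text \<open>Taking converses reverses the order of a relational composition, which matches the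
  reversal of the letters.\<close>

lemma word_rel_inv_word: "word_rel (inv_word w) = converse (word_rel w)"
  by (induction w) (auto simp: inv_word_def word_rel_append)

text \<open>Membership in \<open>stab\<close> asks for some representing word that is defined at the
  base point and fixes it; other words of the same class may be undefined there. Closure is
  therefore checked on such witnesses, by reversing or concatenating them.\<close>

lemma subgroup_stab:
  assumes P: "converse ` P = P"
  shows "subgroup (stab P a) (free_grp P)"
proof -
  interpret group "free_grp P" by (rule group_free_grp[OF P])
  show ?thesis
  proof (rule subgroupI)
    show "stab P a \<subseteq> carrier (free_grp P)"
      by (auto simp: stab_def)
    have "word_class P [] \<in> stab P a"
      unfolding stab_def by force
    then show "stab P a \<noteq> {}"
      by blast
  next
    fix g assume "g \<in> stab P a"
    then obtain w where w: "w \<in> lists P" "g = word_class P w" "(a, a) \<in> word_rel w"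
      by (auto simp: stab_def)
    then have "(a, a) \<in> word_rel (inv_word w)"
      by (simp add: word_rel_inv_word)
    with w inv_word_lists[OF P w(1)] show "inv\<^bsub>free_grp P\<^esub> g \<in> stab P a"
      unfolding stab_def by (auto simp: inv_word_class[OF P])
  next
    fix g h assume "g \<in> stab P a" "h \<in> stab P a"
    then obtain u v where u: "u \<in> lists P" "g = word_class P u" "(a, a) \<in> word_rel u"
      and v: "v \<in> lists P" "h = word_class P v" "(a, a) \<in> word_rel v"
      by (auto simp: stab_def)
    then have "u @ v \<in> lists P" "(a, a) \<in> word_rel (u @ v)"
      by (auto simp: word_rel_append)
    with u v show "g \<otimes>\<^bsub>free_grp P\<^esub> h \<in> stab P a"
      unfolding stab_def by (auto simp: mult_word_class simp del: append_in_lists_conv)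
  qed
qed

text \<open>The letters of \<open>v\<close> act first and lead from \<open>a\<close> to
  \<open>b\<close>; the inverse word of \<open>u\<close> then leads back from \<open>b\<close> to
  \<open>a\<close>.\<close>

lemma inv_mult_in_stab:
  assumes P: "converse ` P = P" and "u \<in> lists P" "v \<in> lists P"
    and "(a, b) \<in> word_rel u" "(a, b) \<in> word_rel v"
  shows "inv\<^bsub>free_grp P\<^esub> (word_class P u) \<otimes>\<^bsub>free_grp P\<^esub> word_class P v \<in> stab P a"
proof -
  have "inv_word u @ v \<in> lists P"
    using assms inv_word_lists[OF P] by auto
  moreover have "(a, a) \<in> word_rel (inv_word u @ v)"
    using assms by (auto simp: word_rel_append word_rel_inv_word)
  ultimately show ?thesis
    using assms unfolding stab_def
    by (auto simp: inv_word_class[OF P] mult_word_class inv_word_lists[OF P]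
        simp del: append_in_lists_conv)
qed


section \<open>Left translation on cosets\<close>

text \<open>Associativity turns \<open>h <# (g <# K)\<close> into the coset of
  \<open>h \<otimes> g\<close>, so translations compose as the group does and translation by
  \<open>inv g\<close> undoes translation by \<open>g\<close>. They are restricted to the cosets
  because elements of \<open>Bij\<close> are extensional.\<close>

lemma (in group) lcosets_translation_hom:
  assumes "K \<subseteq> carrier G"
  shows "(\<lambda>g. \<lambda>x\<in>lcosets K. g <# x) \<in> hom G (BijGroup (lcosets K))"
proof -
  have sub: "x \<subseteq> carrier G" if "x \<in> lcosets K" for x
    using that assms l_coset_subset_G by (auto simp: LCOSETS_def)
  have mem: "g <# x \<in> lcosets K" if "g \<in> carrier G" "x \<in> lcosets K" for g x
    using that assms by (auto simp: LCOSETS_def lcos_m_assoc)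
  have bij: "(\<lambda>x\<in>lcosets K. g <# x) \<in> Bij (lcosets K)" if g: "g \<in> carrier G" for g
  proof -
    have "bij_betw (\<lambda>x. g <# x) (lcosets K) (lcosets K)"
      by (rule bij_betw_byWitness[where f' = "\<lambda>x. inv g <# x"])
        (use g sub mem in \<open>auto simp: lcos_m_assoc lcos_mult_one\<close>)
    then show ?thesis
      by (simp add: Bij_def)
  qed
  show ?thesis
    using bij mem sub
    by (auto simp: hom_def BijGroup_def compose_def lcos_m_assoc fun_eq_iff restrict_def)
qed

text \<open>By normality gNH = (Ng)H, so a left coset of NH is determined by a coset of N, and there
  are only finitely many of those.\<close>

lemma (in group) finite_lcosets_set_mult:
  assumes N: "N \<lhd> G" and H: "H \<subseteq> carrier G" and fin: "finite (rcosets N)"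
  shows "finite (lcosets (N <#> H))"
proof -
  have sub: "N \<subseteq> carrier G"
    using N normal_imp_subgroup subgroup.subset by blast
  have "g <# (N <#> H) = (N #> g) <#> H" if "g \<in> carrier G" for g
    using that N H sub normal.coset_eq by (metis setmult_lcos_assoc)
  then have "lcosets (N <#> H) \<subseteq> (\<lambda>C. C <#> H) ` (rcosets N)"
    by (auto simp: LCOSETS_def RCOSETS_def)
  then show ?thesis
    using fin finite_surj by blast
qed

text \<open>This is the form in which (C2) gets applied. Equal cosets give p = qnh with n in N and h
  in H; then the element \<open>p \<otimes> inv h \<otimes> inv q\<close> of the product is the
  conjugate of n by q, hence lies in N.\<close>

lemma (in group) lcos_set_mult_meets_H_product:
  assumes N: "N \<lhd> G" and H: "subgroup H G" and "p \<in> carrier G" "q \<in> carrier G"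
    and eq: "p <# (N <#> H) = q <# (N <#> H)"
  shows "N \<inter> H_product G H p [] q \<noteq> {}"
proof -
  interpret N: normal N G by (rule N)
  interpret H: subgroup H G by (rule H)
  have "\<one> \<otimes> \<one> \<in> N <#> H"
    unfolding set_mult_def using N.one_closed H.one_closed by blast
  then have "p \<in> p <# (N <#> H)"
    using assms(3) unfolding l_coset_def by force
  then obtain n h where n: "n \<in> N" and h: "h \<in> H" and p: "p = q \<otimes> (n \<otimes> h)"
    unfolding eq by (auto simp: l_coset_def set_mult_def)
  have "p \<otimes> inv h \<otimes> inv q = q \<otimes> n \<otimes> inv q"
    using n h assms(4) by (simp add: p m_assoc)
  moreover have "q \<otimes> n \<otimes> inv q \<in> N"
    using N.inv_op_closed2 n assms(4) by blast
  moreover have "p \<otimes> inv h \<otimes> inv q \<in> H_product G H p [] q"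
    using h by (auto simp: H_product_def l_coset_def r_coset_def)
  ultimately show ?thesis
    by auto
qed


section \<open>Metric identification\<close>

context
  fixes M :: "'b set" and \<rho> :: "'b \<Rightarrow> 'b \<Rightarrow> real"
  assumes pseudo: "pseudometric_on M \<rho>"
begin

lemma pseudometric_self: "x \<in> M \<Longrightarrow> \<rho> x x = 0"
  and pseudometric_nonneg: "x \<in> M \<Longrightarrow> y \<in> M \<Longrightarrow> 0 \<le> \<rho> x y"
  and pseudometric_commute: "x \<in> M \<Longrightarrow> y \<in> M \<Longrightarrow> \<rho> x y = \<rho> y x"
  and pseudometric_triangle:
    "x \<in> M \<Longrightarrow> y \<in> M \<Longrightarrow> z \<in> M \<Longrightarrow> \<rho> x z \<le> \<rho> x y + \<rho> y z"
  using pseudo unfolding pseudometric_on_def by blast+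

lemma equiv_zero_rel: "equiv M (zero_rel M \<rho>)"
proof (rule equivI)
  show "trans (zero_rel M \<rho>)"
  proof (rule transI)
    fix x y z assume "(x, y) \<in> zero_rel M \<rho>" "(y, z) \<in> zero_rel M \<rho>"
    then have "x \<in> M" "y \<in> M" "z \<in> M" and "\<rho> x y = 0" "\<rho> y z = 0"
      by (auto simp: zero_rel_def)
    then show "(x, z) \<in> zero_rel M \<rho>"
      using pseudometric_triangle[of x y z] pseudometric_nonneg[of x z] by (simp add: zero_rel_def)
  qed
qed (auto simp: refl_on_def sym_def zero_rel_def pseudometric_self dest: pseudometric_commute)

lemma zero_rel_class_eq_iff:
  "x \<in> M \<Longrightarrow> y \<in> M \<Longrightarrow> zero_rel M \<rho> `` {x} = zero_rel M \<rho> `` {y} \<longleftrightarrow> \<rho> x y = 0"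
  using eq_equiv_class_iff[OF equiv_zero_rel] by (simp add: zero_rel_def)

lemma metric_ident_class: "x \<in> M \<Longrightarrow> zero_rel M \<rho> `` {x} \<in> metric_ident M \<rho>"
  by (simp add: metric_ident_def quotientI)

lemma metric_identE:
  assumes "A \<in> metric_ident M \<rho>"
  obtains x where "x \<in> M" "A = zero_rel M \<rho> `` {x}"
  using assms by (auto simp: metric_ident_def elim!: quotientE)

lemma zero_rel_dist_eq:
  assumes "(x, x') \<in> zero_rel M \<rho>" "(y, y') \<in> zero_rel M \<rho>"
  shows "\<rho> x' y' = \<rho> x y"
proof -
  have M: "x \<in> M" "x' \<in> M" "y \<in> M" "y' \<in> M" and 0: "\<rho> x x' = 0" "\<rho> y y' = 0"
    using assms by (auto simp: zero_rel_def)
  note tri = pseudometric_triangle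
  have "\<rho> x' x = 0" "\<rho> y' y = 0"
    using pseudometric_commute M 0 by metis+
  \<comment> \<open>The first two instances of the triangle inequality give
    \<open>\<rho> x y \<le> \<rho> x' y'\<close>, the last two the reverse.\<close>
  then show ?thesis
    using tri[of x x' y] tri[of x' y' y] tri[of x' x y'] tri[of x y y'] M 0
    by linarith
qed

text \<open>Distances between representatives do not depend on the choice, so the set under
  \<open>the_elem\<close> is a singleton.\<close>

lemma ident_dist_class:
  assumes "x \<in> M" "y \<in> M"
  shows "ident_dist M \<rho> (zero_rel M \<rho> `` {x}) (zero_rel M \<rho> `` {y}) = \<rho> x y"
proof -
  have "{\<rho> u v | u v. u \<in> zero_rel M \<rho> `` {x} \<and> v \<in> zero_rel M \<rho> `` {y}} = {\<rho> x y}" (is "?D = _")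
  proof
    show "?D \<subseteq> {\<rho> x y}"
      using zero_rel_dist_eq by blast
    show "{\<rho> x y} \<subseteq> ?D"
      using assms[THEN equiv_class_self[OF equiv_zero_rel]] by blast
  qed
  then show ?thesis
    using metric_ident_class assms by (simp add: ident_dist_def)
qed

lemma Metric_space_metric_ident: "Metric_space (metric_ident M \<rho>) (ident_dist M \<rho>)"
proof
  fix A B
  have "0 \<le> ident_dist M \<rho> A B \<and> ident_dist M \<rho> A B = ident_dist M \<rho> B A"
  proof (cases "A \<in> metric_ident M \<rho> \<and> B \<in> metric_ident M \<rho>")
    case True
    then show ?thesis
      by (elim conjE metric_identE)
        (simp add: ident_dist_class pseudometric_nonneg pseudometric_commute)
  qed (auto simp: ident_dist_def)
  then show "0 \<le> ident_dist M \<rho> A B" "ident_dist M \<rho> A B = ident_dist M \<rho> B A"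
    by blast+
next
  fix A B assume "A \<in> metric_ident M \<rho>" "B \<in> metric_ident M \<rho>"
  then show "ident_dist M \<rho> A B = 0 \<longleftrightarrow> A = B"
    by (elim metric_identE) (simp add: ident_dist_class zero_rel_class_eq_iff)
next
  fix A B C assume "A \<in> metric_ident M \<rho>" "B \<in> metric_ident M \<rho>" "C \<in> metric_ident M \<rho>"
  then show "ident_dist M \<rho> A C \<le> ident_dist M \<rho> A B + ident_dist M \<rho> B C"
    by (elim metric_identE) (simp add: ident_dist_class pseudometric_triangle)
qed

section \<open>Maps induced on the metric identification\<close>

lemma ident_map_class:
  assumes f: "f \<in> M \<rightarrow> M" and inv: "invariant_under {f} M \<rho>" and x: "x \<in> M"
  shows "ident_map M \<rho> f (zero_rel M \<rho> `` {x}) = zero_rel M \<rho> `` {f x}"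
proof -
  have "zero_rel M \<rho> `` {f y} = zero_rel M \<rho> `` {f x}" if y: "y \<in> zero_rel M \<rho> `` {x}" for y
  proof -
    have "y \<in> M" "\<rho> x y = 0"
      using y by (auto simp: zero_rel_def)
    moreover have "\<rho> (f x) (f y) = \<rho> x y"
      using inv x \<open>y \<in> M\<close> by (simp add: invariant_under_def)
    ultimately show ?thesis
      using zero_rel_class_eq_iff[of "f x" "f y"] f x by auto
  qed
  moreover have "x \<in> zero_rel M \<rho> `` {x}"
    using equiv_class_self[OF equiv_zero_rel x] .
  ultimately have "(\<Union>y\<in>zero_rel M \<rho> `` {x}. zero_rel M \<rho> `` {f y}) = zero_rel M \<rho> `` {f x}"
    by blast
  then show ?thesis
    using metric_ident_class[OF x] by (simp add: ident_map_def)
qed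

text \<open>Injectivity need not be traced back to \<open>f\<close>: a distance-preserving map on a
  genuine metric space is injective. Surjectivity is inherited from \<open>f\<close>.\<close>

lemma ident_map_IsoGroup:
  assumes f: "f \<in> Bij M" and inv: "invariant_under {f} M \<rho>"
  shows "ident_map M \<rho> f \<in> carrier (IsoGroup (metric_ident M \<rho>) (ident_dist M \<rho>))"
proof -
  let ?Y = "metric_ident M \<rho>" and ?F = "ident_map M \<rho> f"
  interpret Metric_space ?Y "ident_dist M \<rho>"
    by (rule Metric_space_metric_ident)
  note cls = ident_map_class[OF Bij_imp_funcset[OF f] inv]
  have fM: "f x \<in> M" if "x \<in> M" for x
    using Bij_imp_funcset[OF f] that by blast
  have isom: "ident_dist M \<rho> (?F A) (?F B) = ident_dist M \<rho> A B" if "A \<in> ?Y" "B \<in> ?Y" for A B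
    using that inv by (elim metric_identE) (simp add: cls ident_dist_class fM invariant_under_def)
  have F: "?F A \<in> ?Y" if "A \<in> ?Y" for A
    using that by (elim metric_identE) (simp add: cls fM metric_ident_class)
  have "inj_on ?F ?Y"
    by (rule inj_onI) (metis F isom zero)
  moreover have "?Y \<subseteq> ?F ` ?Y"
  proof
    fix A assume "A \<in> ?Y"
    then obtain x where x: "x \<in> M" "A = zero_rel M \<rho> `` {x}"
      by (rule metric_identE)
    moreover obtain y where "y \<in> M" "x = f y"
      using x(1) f by (auto simp: Bij_def bij_betw_def)
    ultimately show "A \<in> ?F ` ?Y"
      using cls metric_ident_class by blast
  qed
  ultimately have "?F \<in> Bij ?Y"
    using F by (auto simp: Bij_def bij_betw_def ident_map_def)
  then show ?thesis
    using isom by (simp add: IsoGroup_def)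
qed

text \<open>Passing to the metric identification respects composition, so any action by
  \<open>\<rho>\<close>-preserving bijections descends to an action by isometries.\<close>

lemma ident_map_hom:
  fixes G (structure)
  assumes \<alpha>: "\<alpha> \<in> hom G (BijGroup M)" and inv: "invariant_under (\<alpha> ` carrier G) M \<rho>"
  shows "(\<lambda>g. ident_map M \<rho> (\<alpha> g)) \<in> hom G (IsoGroup (metric_ident M \<rho>) (ident_dist M \<rho>))"
proof (rule homI)
  have bij: "\<alpha> g \<in> Bij M" and inv': "invariant_under {\<alpha> g} M \<rho>" if "g \<in> carrier G" for g
    using that \<alpha> inv by (auto simp: hom_def BijGroup_def invariant_under_def)
  show iso: "ident_map M \<rho> (\<alpha> g) \<in> carrier (IsoGroup (metric_ident M \<rho>) (ident_dist M \<rho>))"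
    if "g \<in> carrier G" for g
    by (intro ident_map_IsoGroup bij inv' that)
  fix g h assume g: "g \<in> carrier G" and h: "h \<in> carrier G"
  let ?Y = "metric_ident M \<rho>"
  note cls = ident_map_class[OF Bij_imp_funcset[OF bij] inv']
  have gh: "\<alpha> (g \<otimes> h) = compose M (\<alpha> g) (\<alpha> h)"
    using \<alpha> g h bij by (simp add: hom_def BijGroup_def)
  have inv_gh: "invariant_under {compose M (\<alpha> g) (\<alpha> h)} M \<rho>"
    using inv' Bij_imp_funcset[OF bij] g h by (simp add: invariant_under_def compose_def Pi_iff)
  \<comment> \<open>Equality in the group is equality of functions on the whole type, so
    \<open>A\<close> is arbitrary; outside the quotient both sides are
    \<open>undefined\<close>.\<close>
  have "ident_map M \<rho> (\<alpha> (g \<otimes> h)) A = compose ?Y (ident_map M \<rho> (\<alpha> g)) (ident_map M \<rho> (\<alpha> h)) A"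
    for A
  proof (cases "A \<in> ?Y")
    case True
    then obtain x where x: "x \<in> M" "A = zero_rel M \<rho> `` {x}"
      by (rule metric_identE)
    moreover have "\<alpha> h x \<in> M"
      using Bij_imp_funcset[OF bij[OF h]] x(1) by blast
    ultimately show ?thesis
      using True ident_map_class[OF Bij_imp_funcset[OF compose_Bij] inv_gh] bij g h
      by (simp add: gh cls compose_def)
  next
    case False
    then show ?thesis
      by (simp add: ident_map_def compose_def)
  qed
  then have "ident_map M \<rho> (\<alpha> (g \<otimes> h)) = compose ?Y (ident_map M \<rho> (\<alpha> g)) (ident_map M \<rho> (\<alpha> h))"
    by blast
  moreover have "ident_map M \<rho> (\<alpha> k) \<in> Bij ?Y" if "k \<in> carrier G" for k
    using iso[OF that] by (simp add: IsoGroup_def)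
  ultimately show "ident_map M \<rho> (\<alpha> (g \<otimes> h)) =
      ident_map M \<rho> (\<alpha> g) \<otimes>\<^bsub>IsoGroup ?Y (ident_dist M \<rho>)\<^esub> ident_map M \<rho> (\<alpha> h)"
    using g h by (simp add: IsoGroup_def BijGroup_def)
qed

end


section \<open>The extension\<close>

theorem theorem4p6:
  fixes X :: "'a set" and d :: "'a \<Rightarrow> 'a \<Rightarrow> real" and a\<^sub>0 :: 'a
    and P :: "'a rel set" and N :: "'a rel list set set"
    and \<rho> :: "'a rel list set set \<Rightarrow> 'a rel list set set \<Rightarrow> real"
  assumes "Metric_space X d" and "finite X" and "a\<^sub>0 \<in> X"
    and "P \<subseteq> nontrivial_partial_isometries X d" and "converse ` P = P"
    and "X - {a\<^sub>0} \<subseteq> values_at P a\<^sub>0"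
    and "N \<lhd> free_grp P" and "finite (rcosets\<^bsub>free_grp P\<^esub> N)"
    and "cond_C1 d a\<^sub>0 P N" and "cond_C2 a\<^sub>0 P N" and "cond_C3 d a\<^sub>0 P N"
    and "pseudometric_on (Gamma a\<^sub>0 P N) \<rho>"
    and "invariant_under (Phi a\<^sub>0 P N ` carrier (free_grp P)) (Gamma a\<^sub>0 P N) \<rho>"
    and "consistent_with (weighted_edges d a\<^sub>0 P N) \<rho>"
  shows "isometric_embedding X d
           (metric_ident (Gamma a\<^sub>0 P N) \<rho>) (ident_dist (Gamma a\<^sub>0 P N) \<rho>) (e_bar a\<^sub>0 P N \<rho>) \<and>
         finite (metric_ident (Gamma a\<^sub>0 P N) \<rho>) \<and>
         minimal_S_extension X d a\<^sub>0 P
           (metric_ident (Gamma a\<^sub>0 P N) \<rho>) (ident_dist (Gamma a\<^sub>0 P N) \<rho>) (e_bar a\<^sub>0 P N \<rho>)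
           (Phi_bar a\<^sub>0 P N \<rho>)"
proof -
  note P = \<open>converse ` P = P\<close> and pseudo = \<open>pseudometric_on (Gamma a\<^sub>0 P N) \<rho>\<close>
  let ?F = "free_grp P" and ?\<Gamma> = "Gamma a\<^sub>0 P N"
  let ?Y = "metric_ident ?\<Gamma> \<rho>" and ?dY = "ident_dist ?\<Gamma> \<rho>"
  let ?\<Phi> = "\<lambda>g. ident_map ?\<Gamma> \<rho> (Phi a\<^sub>0 P N g)"
  define K where "K = N <#>\<^bsub>?F\<^esub> stab P a\<^sub>0"
  interpret F: group ?F by (rule group_free_grp[OF P])
  interpret H: subgroup "stab P a\<^sub>0" ?F by (rule subgroup_stab[OF P])
  \<comment> \<open>The setting of the second isomorphism theorem supplies that NH is a subgroup
    containing H.\<close>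
  interpret snd: second_isomorphism_grp N ?F "stab P a\<^sub>0"
    by (intro second_isomorphism_grp.intro \<open>N \<lhd> ?F\<close>
        second_isomorphism_grp_axioms.intro H.subgroup_axioms)
  have K: "subgroup K ?F"
    unfolding K_def by (rule snd.normal_set_mult_subgroup)
  note K_sub = subgroup.subset[OF K]
  have stab_K: "stab P a\<^sub>0 \<subseteq> K"
    unfolding K_def by (rule snd.S_contained_in_set_mult)
  have \<Gamma>: "?\<Gamma> = lcosets\<^bsub>?F\<^esub> K"
    by (simp add: Gamma_def K_def)
  have coset_\<Gamma>: "g <#\<^bsub>?F\<^esub> K \<in> ?\<Gamma>" if "g \<in> carrier ?F" for g
    using that by (auto simp: \<Gamma> LCOSETS_def)
  \<comment> \<open>Stated for words of any length, because equivariance of the embedding will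
    compare \<open>p # u\<close> with another word ending at the same point.\<close>
  have coset_eq: "word_class P u <#\<^bsub>?F\<^esub> K = word_class P v <#\<^bsub>?F\<^esub> K"
    if "u \<in> lists P" "v \<in> lists P" "(a\<^sub>0, a) \<in> word_rel u" "(a\<^sub>0, a) \<in> word_rel v" for u v a
  proof (rule F.l_repr_independence[OF _ _ K])
    let ?u = "word_class P u" and ?v = "word_class P v"
    have uv: "?u \<in> carrier ?F" "?v \<in> carrier ?F"
      using that by auto
    have "inv\<^bsub>?F\<^esub> ?u \<otimes>\<^bsub>?F\<^esub> ?v \<in> K"
      using inv_mult_in_stab[OF P that] stab_K by blast
    moreover have "?v = ?u \<otimes>\<^bsub>?F\<^esub> (inv\<^bsub>?F\<^esub> ?u \<otimes>\<^bsub>?F\<^esub> ?v)"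
      using uv by (simp add: F.m_assoc[symmetric])
    ultimately show "?v \<in> ?u <#\<^bsub>?F\<^esub> K"
      unfolding l_coset_def by blast
  qed (use that in auto)

  \<comment> \<open>The two cases of \<open>e_bar\<close> and its use of \<open>SOME\<close> are
    resolved once here. Membership in \<open>gens_at\<close> serves (C2) and the edges of the graph,
    the word serves \<open>coset_eq\<close>.\<close>
  have rep: "\<exists>p w. (p, a) \<in> gens_at P a\<^sub>0 \<and> w \<in> lists P \<and> (a\<^sub>0, a) \<in> word_rel w \<and>
      p = word_class P w \<and> e_bar a\<^sub>0 P N \<rho> a = zero_rel ?\<Gamma> \<rho> `` {p <#\<^bsub>?F\<^esub> K}"
    if a: "a \<in> X" for a
  proof (cases "a = a\<^sub>0")
    case True
    then have "e_bar a\<^sub>0 P N \<rho> a = zero_rel ?\<Gamma> \<rho> `` {\<one>\<^bsub>?F\<^esub> <#\<^bsub>?F\<^esub> K}"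
      by (simp add: e_bar_def F.lcos_mult_one[OF K_sub]) (simp add: K_def)
    then show ?thesis
      using True by (intro exI[of _ "word_class P []"] exI[of _ "[]"])
        (auto simp: gens_at_def one_free_grp)
  next
    case False
    then have "\<exists>p. p \<in> P \<and> (a\<^sub>0, a) \<in> p"
      using \<open>X - {a\<^sub>0} \<subseteq> values_at P a\<^sub>0\<close> a by (auto simp: values_at_def)
    then have "(SOME p. p \<in> P \<and> (a\<^sub>0, a) \<in> p) \<in> P \<and> (a\<^sub>0, a) \<in> (SOME p. p \<in> P \<and> (a\<^sub>0, a) \<in> p)"
      by (rule someI_ex)
    then show ?thesis
      using False by (intro exI[of _ "gen P (SOME p. p \<in> P \<and> (a\<^sub>0, a) \<in> p)"]
          exI[of _ "[SOME p. p \<in> P \<and> (a\<^sub>0, a) \<in> p]"]) (auto simp: gens_at_def e_bar_def K_def)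
  qed

  have \<Phi>_hom: "Phi a\<^sub>0 P N \<in> hom ?F (BijGroup ?\<Gamma>)"
    using F.lcosets_translation_hom[OF K_sub] by (simp add: Phi_def[abs_def] \<Gamma>)
  have bar_hom: "?\<Phi> \<in> hom ?F (IsoGroup ?Y ?dY)"
    by (intro ident_map_hom pseudo \<Phi>_hom assms(13))
  have ext: "hom_extension P ?Y ?dY (Phi_bar a\<^sub>0 P N \<rho>) ?\<Phi>"
    using bar_hom by (simp add: hom_extension_def Phi_bar_def)
  \<comment> \<open>The induced action multiplies coset representatives on the left. Both the
    extension property and minimality reduce to this formula.\<close>
  have \<Phi>_class: "?\<Phi> g (zero_rel ?\<Gamma> \<rho> `` {h <#\<^bsub>?F\<^esub> K}) =
      zero_rel ?\<Gamma> \<rho> `` {(g \<otimes>\<^bsub>?F\<^esub> h) <#\<^bsub>?F\<^esub> K}"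
    if g: "g \<in> carrier ?F" and h: "h \<in> carrier ?F" for g h
  proof -
    have "Phi a\<^sub>0 P N g \<in> Bij ?\<Gamma>" "invariant_under {Phi a\<^sub>0 P N g} ?\<Gamma> \<rho>"
      using \<Phi>_hom assms(13) g by (auto simp: hom_def BijGroup_def invariant_under_def)
    then have "?\<Phi> g (zero_rel ?\<Gamma> \<rho> `` {h <#\<^bsub>?F\<^esub> K}) =
        zero_rel ?\<Gamma> \<rho> `` {Phi a\<^sub>0 P N g (h <#\<^bsub>?F\<^esub> K)}"
      by (intro ident_map_class[OF pseudo] Bij_imp_funcset coset_\<Gamma> h)
    then show ?thesis
      using g h coset_\<Gamma>[OF h] K_sub by (simp add: Phi_def F.lcos_m_assoc)
  qed

  have emb: "isometric_embedding X d ?Y ?dY (e_bar a\<^sub>0 P N \<rho>)"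
    unfolding isometric_embedding_def
  proof (intro conjI ballI)
    show "e_bar a\<^sub>0 P N \<rho> \<in> X \<rightarrow> ?Y"
    proof
      fix a assume "a \<in> X"
      then obtain w where "w \<in> lists P"
        "e_bar a\<^sub>0 P N \<rho> a = zero_rel ?\<Gamma> \<rho> `` {word_class P w <#\<^bsub>?F\<^esub> K}"
        using rep by metis
      then show "e_bar a\<^sub>0 P N \<rho> a \<in> ?Y"
        by (simp only: metric_ident_class[OF pseudo] coset_\<Gamma> word_class_carrier)
    qed
  next
    fix a b assume a: "a \<in> X" and b: "b \<in> X"
    obtain p where p: "(p, a) \<in> gens_at P a\<^sub>0" "p \<in> carrier ?F"
      "e_bar a\<^sub>0 P N \<rho> a = zero_rel ?\<Gamma> \<rho> `` {p <#\<^bsub>?F\<^esub> K}"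
      using rep[OF a] by blast
    obtain q where q: "(q, b) \<in> gens_at P a\<^sub>0" "q \<in> carrier ?F"
      "e_bar a\<^sub>0 P N \<rho> b = zero_rel ?\<Gamma> \<rho> `` {q <#\<^bsub>?F\<^esub> K}"
      using rep[OF b] by blast
    have "\<rho> (p <#\<^bsub>?F\<^esub> K) (q <#\<^bsub>?F\<^esub> K) = d a b"
    \<comment> \<open>Edges join distinct cosets only, so consistency of \<open>\<rho>\<close> says
      nothing when the two cosets coincide. In that case (C2) forces \<open>a = b\<close>, and both
      distances are 0.\<close>
    proof (cases "p <#\<^bsub>?F\<^esub> K = q <#\<^bsub>?F\<^esub> K")
      case True
      then have "N \<inter> H_product ?F (stab P a\<^sub>0) p [] q \<noteq> {}"
        unfolding K_def
        by (rule F.lcos_set_mult_meets_H_product[OF \<open>N \<lhd> ?F\<close> H.subgroup_axioms p(2) q(2)])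
      then have "a = b"
        using \<open>cond_C2 a\<^sub>0 P N\<close>[unfolded cond_C2_def, THEN bspec, OF p(1), unfolded case_prod_conv,
            THEN bspec, OF q(1)]
        by simp
      then have "d a b = 0"
        using Metric_space.mdist_zero[OF \<open>Metric_space X d\<close>] a by blast
      moreover have "\<rho> (q <#\<^bsub>?F\<^esub> K) (q <#\<^bsub>?F\<^esub> K) = 0"
        by (rule pseudometric_self[OF pseudo coset_\<Gamma>[OF q(2)]])
      ultimately show ?thesis
        by (simp add: True)
    next
      case False
      have "(p <#\<^bsub>?F\<^esub> K, q <#\<^bsub>?F\<^esub> K, d a b) \<in> weighted_edges d a\<^sub>0 P N"
        unfolding weighted_edges_def K_def[symmetric] mem_Collect_eq case_prod_conv
        using False p(2) q(2)
        by (intro conjI bexI[OF _ F.one_closed] bexI[OF _ p(1)] bexI[OF _ q(1)] case_prodI) simp_all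
      from bspec[OF assms(14)[unfolded consistent_with_def] this] show ?thesis
        by simp
    qed
    then show "?dY (e_bar a\<^sub>0 P N \<rho> a) (e_bar a\<^sub>0 P N \<rho> b) = d a b"
      using p q ident_dist_class[OF pseudo] coset_\<Gamma> by simp
  qed

  have act: "Phi_bar a\<^sub>0 P N \<rho> p (e_bar a\<^sub>0 P N \<rho> a) = e_bar a\<^sub>0 P N \<rho> b"
    if p: "p \<in> P" "(a, b) \<in> p" for p a b
  proof -
    have "partial_isometry X d p"
      using p(1) \<open>P \<subseteq> nontrivial_partial_isometries X d\<close>
      by (auto simp: nontrivial_partial_isometries_def)
    then have "a \<in> X" "b \<in> X"
      using p(2) by (auto simp: partial_isometry_def bij_betw_def)
    then obtain u v where u: "u \<in> lists P" "(a\<^sub>0, a) \<in> word_rel u"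
        "e_bar a\<^sub>0 P N \<rho> a = zero_rel ?\<Gamma> \<rho> `` {word_class P u <#\<^bsub>?F\<^esub> K}"
      and v: "v \<in> lists P" "(a\<^sub>0, b) \<in> word_rel v"
        "e_bar a\<^sub>0 P N \<rho> b = zero_rel ?\<Gamma> \<rho> `` {word_class P v <#\<^bsub>?F\<^esub> K}"
      using rep by metis
    have "gen P p \<otimes>\<^bsub>?F\<^esub> word_class P u = word_class P (p # u)"
      using mult_word_class[of "[p]" P u] u p by simp
    \<comment> \<open>Since \<open>u\<close> carries \<open>a\<^sub>0\<close> to \<open>a\<close>
      and \<open>p\<close> carries \<open>a\<close> to \<open>b\<close>, the words
      \<open>p # u\<close> and \<open>v\<close> both carry \<open>a\<^sub>0\<close> to
      \<open>b\<close>.\<close>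
    moreover have "word_class P (p # u) <#\<^bsub>?F\<^esub> K = word_class P v <#\<^bsub>?F\<^esub> K"
      by (rule coset_eq[of _ _ b]) (use u v p in auto)
    ultimately show ?thesis
      using \<Phi>_class[of "gen P p" "word_class P u"] u v p
      by (simp add: Phi_bar_def word_class_carrier)
  qed

  \<comment> \<open>The base point is sent to the class of K = 1K, and translating by
    \<open>g\<close> reaches the class of gK, so the orbit is everything.\<close>
  have orbit: "\<exists>g\<in>carrier ?F. y = ?\<Phi> g (e_bar a\<^sub>0 P N \<rho> a\<^sub>0)" if y: "y \<in> ?Y" for y
  proof -
    obtain x where x: "x \<in> ?\<Gamma>" "y = zero_rel ?\<Gamma> \<rho> `` {x}"
      using y by (rule metric_identE[OF pseudo])
    then obtain g where g: "g \<in> carrier ?F" "x = g <#\<^bsub>?F\<^esub> K"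
      by (auto simp: \<Gamma> LCOSETS_def)
    have "e_bar a\<^sub>0 P N \<rho> a\<^sub>0 = zero_rel ?\<Gamma> \<rho> `` {\<one>\<^bsub>?F\<^esub> <#\<^bsub>?F\<^esub> K}"
      by (simp add: e_bar_def F.lcos_mult_one[OF K_sub]) (simp add: K_def)
    then have "y = ?\<Phi> g (e_bar a\<^sub>0 P N \<rho> a\<^sub>0)"
      using \<Phi>_class[OF g(1) F.one_closed] g x by simp
    with g show ?thesis
      by blast
  qed

  have gen_iso: "Phi_bar a\<^sub>0 P N \<rho> \<in> P \<rightarrow> carrier (IsoGroup ?Y ?dY)"
  proof
    fix p assume "p \<in> P"
    then have "gen P p \<in> carrier ?F"
      by auto
    then show "Phi_bar a\<^sub>0 P N \<rho> p \<in> carrier (IsoGroup ?Y ?dY)"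
      using hom_in_carrier[OF bar_hom] by (simp add: Phi_bar_def)
  qed

  have "finite ?\<Gamma>"
    unfolding \<Gamma> K_def
    by (rule F.finite_lcosets_set_mult[OF \<open>N \<lhd> ?F\<close> H.subset assms(8)])
  then have "finite ?Y"
    unfolding metric_ident_def quotient_def by simp
  moreover have "\<forall>p\<in>P. \<forall>(a, b)\<in>p.
      Phi_bar a\<^sub>0 P N \<rho> p (e_bar a\<^sub>0 P N \<rho> a) = e_bar a\<^sub>0 P N \<rho> b"
    using act by auto
  moreover have "\<forall>y\<in>?Y. \<exists>g\<in>carrier ?F. y = ?\<Phi> g (e_bar a\<^sub>0 P N \<rho> a\<^sub>0)"
    using orbit by (rule ballI)
  \<comment> \<open>The same homomorphism witnesses both existential statements, the one in
    \<open>S_extension\<close> and the one expressing minimality.\<close>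
  ultimately show ?thesis
    unfolding minimal_S_extension_def S_extension_def
    by (intro conjI exI[of _ ?\<Phi>] emb gen_iso ext Metric_space_metric_ident[OF pseudo])
qed

end
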